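(* Let $G$ be a graph on vertices $1,\dots,n$ and $K=K(G)$. Let $\mathbf{v}\in\mathbb{C}^{2n}$ be an eigenvector of $K$ for the eigenvalue $\lambda\neq0$ and let $\mathbf{u}$ be a vector in $\mathbb{C}^{2n}$. The vector $\mathbf{u}$ is a generalized eigenvector of $K$ such that $K\mathbf{u}=\lambda\mathbf{u}+\mathbf{v}$ if and only if $$\mathbf{u}_{n+i}=\frac{-\mathbf{u}_i}{\lambda}+\frac{\mathbf{v}_i}{\lambda^2}\quad\text{and}\quad \sum_{j\sim i}\mathbf{u}_j=\mathbf{u}_i\frac1\lambda\left(\deg(i)-1+\lambda^2\right)-\mathbf{v}_i\frac1{\lambda^2}\left(\deg(i)-1-\lambda^2\right)$$ for all $1\le i\le n$.
   Context: All graphs are finite, simple and connected. With $A$ the adjacency matrix and $D$ the diagonal degree matrix of $G$, $K(G)$ is the $2n\times2n$ matrix $\begin{bmatrix} A & D-I_n\\ -I_n & 0\end{bmatrix}$. Here $j\sim i$ means that vertices $i,j\in\{1,\dots,n\}$ are adjacent, and $\deg(i)$ is the degree of $i$. *)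

theory Defs
  imports
    Complex_Main
    "Jordan_Normal_Form.Char_Poly"
    "Graph_Theory.Graph_Theory"
begin

text \<open>
  Graphs are symmetric loop-free digraphs without parallel arcs (\<^locale>\<open>pair_graph\<close>).
  Since vectors and matrices are indexed from 0, the vertices of a graph of order n are
  0, ..., n - 1 instead of 1, ..., n. Both halves of a vector of dimension 2n are indexed
  by vertices: vertex i owns the entries i and n + i.
\<close>

abbreviation adjacent :: "'a pair_pre_digraph \<Rightarrow> 'a \<Rightarrow> 'a \<Rightarrow> bool" where
  "adjacent G j i \<equiv> j \<rightarrow>\<^bsub>with_proj G\<^esub> i"

text \<open>In a symmetric digraph without parallel arcs, the out-degree is the number of neighbours.\<close>

abbreviation deg :: "'a pair_pre_digraph \<Rightarrow> 'a \<Rightarrow> nat" where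
  "deg G i \<equiv> out_degree (with_proj G) i"

lemma (in pair_graph) deg_eq_card_neighbours: "deg G i = card {j. adjacent G j i}"
proof -
  have "out_arcs (with_proj G) i = Pair i ` {j. (j, i) \<in> parcs G}"
    using pair_sym_arcs by (auto simp: symmetric_def sym_def)
  then show ?thesis
    by (simp add: out_degree_def card_image inj_on_def)
qed

definition adjacency_mat :: "nat \<Rightarrow> nat pair_pre_digraph \<Rightarrow> complex mat" where
  "adjacency_mat n G = mat n n (\<lambda>(i, j). if adjacent G i j then 1 else 0)"

definition degree_mat :: "nat \<Rightarrow> nat pair_pre_digraph \<Rightarrow> complex mat" where
  "degree_mat n G = mat_diag n (\<lambda>i. of_nat (deg G i))"

definition K_mat :: "nat \<Rightarrow> nat pair_pre_digraph \<Rightarrow> complex mat" where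
  "K_mat n G = four_block_mat
     (adjacency_mat n G) (degree_mat n G - 1\<^sub>m n)
     (- 1\<^sub>m n)           (0\<^sub>m n n)"

lemma K_mat_carrier [simp]: "K_mat n G \<in> carrier_mat (2 * n) (2 * n)"
  unfolding K_mat_def adjacency_mat_def carrier_mat_def by simp

text \<open>
  \<^term>\<open>char_matrix M k\<close> is M - kI. The exponent m is automatically positive, as its zeroth
  power is the identity and u is nonzero.
\<close>

definition generalized_eigenvector :: "'a :: field mat \<Rightarrow> 'a vec \<Rightarrow> 'a \<Rightarrow> bool" where
  "generalized_eigenvector M u k \<longleftrightarrow>
     u \<in> carrier_vec (dim_row M) \<and> u \<noteq> 0\<^sub>v (dim_row M) \<and>
     (\<exists>m. (char_matrix M k ^\<^sub>m m) *\<^sub>v u = 0\<^sub>v (dim_row M))"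

end

theory Submission
  imports Defs
begin

text \<open>
  Write \<open>x\<close> as two halves indexed by vertices. The upper half of \<open>K x\<close> at \<open>i\<close> is the sum
  of \<open>x\<^sub>j\<close> over the neighbours of \<open>i\<close> plus \<open>(deg i - 1) x\<^bsub>n+i\<^esub>\<close>, the lower half is \<open>- x\<^sub>i\<close>
  (\<open>K_mat_mult_upper\<close>, \<open>K_mat_mult_lower\<close>). Read off from \<open>K v = lam v\<close>, the lower half gives
  \<open>v\<^bsub>n+i\<^esub> = - v\<^sub>i / lam\<close>. Hence the lower half of \<open>K u = lam u + v\<close> is the stated formula for
  \<open>u\<^bsub>n+i\<^esub>\<close>, and substituting that formula into the upper half gives the stated neighbour sum;
  both steps are reversible because \<open>lam\<close> is nonzero.

  That \<open>u\<close> is a generalized eigenvector is then automatic: it heads a Jordan chain of length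
  two ending in the eigenvector \<open>v\<close> (\<open>jordan_chain_generalized_eigenvector\<close>).
\<close>

lemma K_mat_mult_lower:
  assumes "x \<in> carrier_vec (2 * n)" and "i < n"
  shows "(K_mat n G *\<^sub>v x) $ (n + i) = - (x $ i)"
proof -
  have "(K_mat n G *\<^sub>v x) $ (n + i) = (\<Sum>j = 0..<n + n. K_mat n G $$ (n + i, j) * x $ j)"
    using assms by (simp add: scalar_prod_def mult_2[symmetric] carrier_matD[OF K_mat_carrier])
  also have "\<dots> = (\<Sum>j = 0..<n. (if j = i then - (x $ j) else 0))
      + (\<Sum>j = n..<n + n. K_mat n G $$ (n + i, j) * x $ j)"
    using assms
    by (subst sum.atLeastLessThan_concat[symmetric, of 0 n "n + n"], simp, simp,
        intro arg_cong2[where f = "(+)"] sum.cong)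
      (auto simp: K_mat_def adjacency_mat_def degree_mat_def)
  also have "(\<Sum>j = n..<n + n. K_mat n G $$ (n + i, j) * x $ j) = 0"
    using assms by (intro sum.neutral) (auto simp: K_mat_def adjacency_mat_def degree_mat_def)
  finally show ?thesis
    using assms by simp
qed

text \<open>
  Row \<open>i\<close> of the adjacency matrix collects the arcs leaving \<open>i\<close>; symmetry of the graph turns
  them into the arcs entering \<open>i\<close>.
\<close>

lemma K_mat_mult_upper:
  assumes "pair_graph G" and "pverts G = {0..<n}" and "x \<in> carrier_vec (2 * n)" and "i < n"
  shows "(K_mat n G *\<^sub>v x) $ i
    = (\<Sum>j | adjacent G j i. x $ j) + (of_nat (deg G i) - 1) * x $ (n + i)"
proof -
  interpret pair_graph G by fact
  have adj_sym: "(i, j) \<in> parcs G \<longleftrightarrow> (j, i) \<in> parcs G" for j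
    using pair_sym_arcs by (auto simp: symmetric_def sym_def)
  have adj_less: "j < n" if "(j, i) \<in> parcs G" for j
    using in_arcsD1[OF that] assms(2) by simp
  have "(K_mat n G *\<^sub>v x) $ i = (\<Sum>j = 0..<n + n. K_mat n G $$ (i, j) * x $ j)"
    using assms by (simp add: scalar_prod_def mult_2[symmetric] carrier_matD[OF K_mat_carrier])
  also have "\<dots> = (\<Sum>j = 0..<n. (if adjacent G j i then x $ j else 0))
      + (\<Sum>j = 0 + n..<n + n. K_mat n G $$ (i, j) * x $ j)"
    using assms adj_sym
    by (subst sum.atLeastLessThan_concat[symmetric, of 0 n "n + n"])
      (auto simp: K_mat_def adjacency_mat_def degree_mat_def intro!: sum.cong)
  also have "(\<Sum>j = 0 + n..<n + n. K_mat n G $$ (i, j) * x $ j)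
      = (\<Sum>j = 0..<n. if j = i then (of_nat (deg G i) - 1) * x $ (n + i) else 0)"
    unfolding sum.shift_bounds_nat_ivl using assms
    by (intro sum.cong)
      (auto simp: K_mat_def adjacency_mat_def degree_mat_def mat_diag_def add.commute)
  also have "\<dots> = (of_nat (deg G i) - 1) * x $ (n + i)"
    using assms by simp
  also have "(\<Sum>j = 0..<n. (if adjacent G j i then x $ j else 0)) = (\<Sum>j | adjacent G j i. x $ j)"
    using adj_less by (intro sum.mono_neutral_cong_right) auto
  finally show ?thesis .
qed

text \<open>
  Two applications of \<open>M - k I\<close> annihilate \<open>u\<close>, the first one yielding \<open>v\<close>; and \<open>u\<close> is nonzero
  because \<open>u = 0\<close> would force \<open>v = 0\<close>.
\<close>

lemma jordan_chain_generalized_eigenvector: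
  fixes M :: "'a :: field mat"
  assumes M: "M \<in> carrier_mat n n" and u: "u \<in> carrier_vec n"
    and v: "eigenvector M v k" and Mu: "M *\<^sub>v u = k \<cdot>\<^sub>v u + v"
  shows "generalized_eigenvector M u k"
proof -
  let ?N = "char_matrix M k"
  have v_carrier: "v \<in> carrier_vec n" and "v \<noteq> 0\<^sub>v n" and Mv: "M *\<^sub>v v = k \<cdot>\<^sub>v v"
    using v M by (auto simp: eigenvector_def)
  have N: "?N \<in> carrier_mat n n"
    using M by (simp add: char_matrix_def)
  have N_mult: "?N *\<^sub>v w = M *\<^sub>v w - k \<cdot>\<^sub>v w" if "w \<in> carrier_vec n" for w
    using M that by (auto simp: char_matrix_def add_mult_distrib_mat_vec[where nr = n and nc = n])
  have "?N *\<^sub>v u = v"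
    using N_mult[OF u] Mu u v_carrier by auto
  moreover have "?N *\<^sub>v v = 0\<^sub>v n"
    using N_mult[OF v_carrier] Mv v_carrier by simp
  ultimately have "(?N ^\<^sub>m 2) *\<^sub>v u = 0\<^sub>v n"
    using N u by (simp add: numeral_2_eq_2 assoc_mult_mat_vec[where n\<^sub>1 = n and n\<^sub>2 = n and n\<^sub>3 = n])
  moreover have "u \<noteq> 0\<^sub>v n"
  proof
    assume "u = 0\<^sub>v n"
    moreover have "M *\<^sub>v 0\<^sub>v n = 0\<^sub>v n"
      using M by (intro eq_vecI) auto
    moreover have "k \<cdot>\<^sub>v 0\<^sub>v n = 0\<^sub>v n"
      by (intro eq_vecI) auto
    ultimately have "v = 0\<^sub>v n"
      using Mu v_carrier by simp
    with \<open>v \<noteq> 0\<^sub>v n\<close> show False by contradiction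
  qed
  ultimately show ?thesis
    using M u by (auto simp: generalized_eigenvector_def)
qed

lemma vec_eq_iff_halves:
  assumes "x \<in> carrier_vec (2 * n)" and "y \<in> carrier_vec (2 * n)"
  shows "x = y \<longleftrightarrow> (\<forall>i<n. x $ i = y $ i \<and> x $ (n + i) = y $ (n + i))"
proof
  assume halves: "\<forall>i<n. x $ i = y $ i \<and> x $ (n + i) = y $ (n + i)"
  show "x = y"
  proof (rule eq_vecI)
    fix k assume "k < dim_vec y"
    with assms(2) have "k < n \<or> k - n < n \<and> k = n + (k - n)" by auto
    with halves show "x $ k = y $ k" by metis
  qed (use assms in simp)
qed simp

theorem proposition3p2:
  fixes G :: "nat pair_pre_digraph" and n :: nat
    and u v :: "complex vec" and lam :: complex
  assumes "pair_graph G"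
    and "Digraph_Component.connected (with_proj G)"
    and "pverts G = {0..<n}"
    and "eigenvector (K_mat n G) v lam"
    and "lam \<noteq> 0"
    and "u \<in> carrier_vec (2 * n)"
  shows "(generalized_eigenvector (K_mat n G) u lam \<and> K_mat n G *\<^sub>v u = lam \<cdot>\<^sub>v u + v) \<longleftrightarrow>
    (\<forall>i<n.
       u $ (n + i) = - (u $ i) / lam + v $ i / lam\<^sup>2 \<and>
       (\<Sum>j | adjacent G j i. u $ j) =
         u $ i * (1 / lam) * (of_nat (deg G i) - 1 + lam\<^sup>2)
         - v $ i * (1 / lam\<^sup>2) * (of_nat (deg G i) - 1 - lam\<^sup>2))"
proof -
  let ?K = "K_mat n G" and ?d = "\<lambda>i. of_nat (deg G i) :: complex"
    and ?S = "\<lambda>i. \<Sum>j | adjacent G j i. u $ j"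
  have K: "?K \<in> carrier_mat (2 * n) (2 * n)" by simp
  have v: "v \<in> carrier_vec (2 * n)" and Kv: "?K *\<^sub>v v = lam \<cdot>\<^sub>v v"
    using assms(4) K unfolding eigenvector_def carrier_mat_def by auto
  have v_lower: "v $ (n + i) = - (v $ i) / lam" if "i < n" for i
  proof -
    have "lam * v $ (n + i) = - (v $ i)"
      using K_mat_mult_lower[OF v that, of G] that v unfolding Kv by simp
    then show ?thesis
      using assms(5) by (simp add: field_simps)
  qed
  have "generalized_eigenvector ?K u lam \<and> ?K *\<^sub>v u = lam \<cdot>\<^sub>v u + v \<longleftrightarrow> ?K *\<^sub>v u = lam \<cdot>\<^sub>v u + v"
    using jordan_chain_generalized_eigenvector[OF K assms(6,4)] by blast
  also have "\<dots> \<longleftrightarrow> (\<forall>i<n. ?S i + (?d i - 1) * u $ (n + i) = lam * u $ i + v $ i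
      \<and> - (u $ i) = lam * u $ (n + i) + v $ (n + i))"
  proof -
    have "?K *\<^sub>v u \<in> carrier_vec (2 * n)" and "lam \<cdot>\<^sub>v u + v \<in> carrier_vec (2 * n)"
      using mult_mat_vec_carrier[OF K assms(6)] assms(6) v by simp_all
    from vec_eq_iff_halves[OF this] show ?thesis
      using assms(6) v
      by (simp add: K_mat_mult_upper[OF assms(1,3,6)] K_mat_mult_lower[OF assms(6)])
  qed
  also have "\<dots> \<longleftrightarrow> (\<forall>i<n.
       u $ (n + i) = - (u $ i) / lam + v $ i / lam\<^sup>2 \<and>
       ?S i = u $ i * (1 / lam) * (?d i - 1 + lam\<^sup>2) - v $ i * (1 / lam\<^sup>2) * (?d i - 1 - lam\<^sup>2))"
  proof -
    have "- (u $ i) = lam * u $ (n + i) + v $ (n + i)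
        \<longleftrightarrow> u $ (n + i) = - (u $ i) / lam + v $ i / lam\<^sup>2" if "i < n" for i
      unfolding v_lower[OF that] using assms(5)
      by (simp add: field_simps power2_eq_square) (auto simp: algebra_simps)
    moreover have "?S i + (?d i - 1) * u $ (n + i) = lam * u $ i + v $ i
        \<longleftrightarrow> ?S i = u $ i * (1 / lam) * (?d i - 1 + lam\<^sup>2)
          - v $ i * (1 / lam\<^sup>2) * (?d i - 1 - lam\<^sup>2)"
      if "u $ (n + i) = - (u $ i) / lam + v $ i / lam\<^sup>2" for i
    proof -
      have "lam * u $ i + v $ i - (?d i - 1) * u $ (n + i)
          = u $ i * (1 / lam) * (?d i - 1 + lam\<^sup>2) - v $ i * (1 / lam\<^sup>2) * (?d i - 1 - lam\<^sup>2)"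
        unfolding that using assms(5) by (simp add: field_simps power2_eq_square)
      then show ?thesis
        by (metis add_diff_cancel_right' diff_add_cancel)
    qed
    ultimately show ?thesis by blast
  qed
  finally show ?thesis .
qed

end
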